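(* Let $\mathcal{F}=\{F_i : i\in\mathbb{N}\}$ be a countable family of contraction maps on the complete metric space $(X,d)$. Let $P$ be the set of fixed points of finite compositions of members of $\mathcal{F}$. Then $\overline{P}$ is the smallest invariant set for $\mathcal{F}$ with respect to inclusion; that is, $\overline{P}$ is an invariant set for $\mathcal{F}$, and $\overline{P}\subset A$ for every invariant set $A$ for $\mathcal{F}$.
   Context: A map $F:X\to X$ is a contraction if there is a constant $c$ with $0<c<1$ such that $d(F(x),F(y))\le c\,d(x,y)$ for all $x,y\in X$. $P$ is the set of all points $x\in X$ such that $F_{i_1}\circ\dots\circ F_{i_k}(x)=x$ for some $k\ge 1$ and some $i_1,\dots,i_k\in\mathbb{N}$. A non-empty set $E\subset X$ is an invariant set for $\mathcal{F}$ if $E=\overline{\bigcup_{i=1}^\infty F_i(E)}$. *)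

theory Defs
  imports "HOL-Analysis.Analysis"
begin

definition contraction_map :: "('a::metric_space \<Rightarrow> 'a) \<Rightarrow> bool" where
  "contraction_map f \<longleftrightarrow>
     (\<exists>c. 0 < c \<and> c < 1 \<and> (\<forall>x y. dist (f x) (f y) \<le> c * dist x y))"

(* word_map F [i\<^sub>1, ..., i\<^sub>k] = F i\<^sub>1 \<circ> ... \<circ> F i\<^sub>k; the empty word gives the identity. *)
definition word_map :: "(nat \<Rightarrow> 'a \<Rightarrow> 'a) \<Rightarrow> nat list \<Rightarrow> 'a \<Rightarrow> 'a" where
  "word_map F w = foldr (\<circ>) (map F w) id"

(* Fixed points of F i\<^sub>1 \<circ> ... \<circ> F i\<^sub>k with k \<ge> 1; the empty word would make every point fixed. *)
definition word_fixed_points :: "(nat \<Rightarrow> 'a \<Rightarrow> 'a) \<Rightarrow> 'a set" where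
  "word_fixed_points F = {x. \<exists>w. w \<noteq> [] \<and> word_map F w x = x}"

definition invariant_set :: "(nat \<Rightarrow> 'a \<Rightarrow> 'a) \<Rightarrow> 'a::topological_space set \<Rightarrow> bool" where
  "invariant_set F E \<longleftrightarrow> E \<noteq> {} \<and> E = closure (\<Union>i. F i ` E)"

end

theory Submission
  imports Defs
begin

text \<open>
  Let \<open>P\<close> be the set of fixed points of the compositions \<open>F i\<^sub>1 \<circ> \<dots> \<circ> F i\<^sub>k\<close> with \<open>k \<ge> 1\<close>. Such
  a composition is a contraction, so it has exactly one fixed point in the whole space. If \<open>A\<close> is
  closed, non-empty and mapped into itself by every \<open>F i\<close>, Banach's theorem applied inside \<open>A\<close>
  shows that this fixed point lies in \<open>A\<close>. Every invariant set is such an \<open>A\<close>, hence contains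
  \<open>closure P\<close> (\<open>word_fixed_points_subset_closed\<close>).

  The invariance of \<open>closure P\<close> rests on two inclusions. On the one hand, \<open>P \<subseteq> (\<Union>i. F i ` P)\<close>
  (\<open>word_fixed_points_subset_images\<close>): if \<open>x\<close> is fixed by \<open>F i \<circ> g\<close>, then \<open>x = F i (g x)\<close>, and
  \<open>g x\<close> is fixed by the rotated composition \<open>g \<circ> F i\<close>. On the other hand, \<open>F i ` P \<subseteq> closure P\<close>
  (\<open>image_word_fixed_points_subset_closure\<close>): \<open>F i x\<close> itself need not be in \<open>P\<close>, but if \<open>x\<close> is
  fixed by \<open>g\<close>, then the fixed points of \<open>F i \<circ> g ^^ n\<close> converge to \<open>F i x\<close>. Indeed
  \<open>F i \<circ> g ^^ n\<close> moves \<open>F i x\<close> by an amount that decays geometrically in \<open>n\<close>, and its Lipschitz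
  constant is at most that of \<open>F i\<close>. Continuity of the \<open>F i\<close> extends the second inclusion from
  \<open>P\<close> to its closure.
\<close>

lemma contraction_map_compose:
  assumes "contraction_map f" "contraction_map g"
  shows "contraction_map (f \<circ> g)"
proof -
  obtain c where c: "0 < c" "c < 1" "\<And>x y. dist (f x) (f y) \<le> c * dist x y"
    using assms(1) by (auto simp: contraction_map_def)
  obtain d where d: "0 < d" "d < 1" "\<And>x y. dist (g x) (g y) \<le> d * dist x y"
    using assms(2) by (auto simp: contraction_map_def)
  have "dist (f (g x)) (f (g y)) \<le> (c * d) * dist x y" for x y
  proof -
    have "dist (f (g x)) (f (g y)) \<le> c * dist (g x) (g y)" by (rule c)
    also have "\<dots> \<le> c * (d * dist x y)" using c d by (intro mult_left_mono) auto
    finally show ?thesis by (simp add: mult.assoc)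
  qed
  moreover have "c * d < 1" using c d mult_strict_mono[of c 1 d 1] by simp
  moreover have "0 < c * d" using c d by simp
  ultimately show ?thesis unfolding contraction_map_def comp_def by blast
qed

lemma contraction_map_continuous_on:
  assumes "contraction_map f"
  shows "continuous_on S f"
proof -
  obtain c where "0 < c" "\<And>x y. dist (f x) (f y) \<le> c * dist x y"
    using assms by (auto simp: contraction_map_def)
  then have "c-lipschitz_on S f" by (intro lipschitz_onI) auto
  then show ?thesis by (rule lipschitz_on_continuous_on)
qed

lemma contraction_map_fixed_point_unique:
  assumes "contraction_map f" "f x = x" "f y = y"
  shows "x = y"
proof -
  obtain c where c: "c < 1" "\<And>x y. dist (f x) (f y) \<le> c * dist x y"
    using assms(1) by (auto simp: contraction_map_def)
  have "(1 - c) * dist x y \<le> 0"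
    using c(2)[of x y] assms(2,3) by (simp add: algebra_simps)
  then show ?thesis using c(1) by (simp add: mult_le_0_iff)
qed

lemma contraction_map_fixed_point_exists:
  fixes f :: "'a::complete_space \<Rightarrow> 'a"
  assumes "contraction_map f" "closed A" "A \<noteq> {}" "f ` A \<subseteq> A"
  shows "\<exists>x\<in>A. f x = x"
proof -
  obtain c where c: "0 < c" "c < 1" "\<And>x y. dist (f x) (f y) \<le> c * dist x y"
    using assms(1) by (auto simp: contraction_map_def)
  have "complete A" using assms(2) by (simp add: complete_eq_closed)
  then have "\<exists>!x\<in>A. f x = x"
    using assms(3) less_imp_le[OF c(1)] c(2) assms(4) c(3) by (rule Banach_fix)
  then show ?thesis by blast
qed

text \<open>The defect of \<open>y\<close> as a fixed point controls its distance to the fixed point: the triangle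
  inequality gives \<open>dist y p \<le> dist y (g y) + c * dist y p\<close>.\<close>

lemma dist_fixed_point_le:
  assumes "c < 1" "\<And>x y. dist (g x) (g y) \<le> c * dist x y" "g p = p"
  shows "dist y p \<le> dist y (g y) / (1 - c)"
proof -
  have "dist y p \<le> dist y (g y) + dist (g y) (g p)"
    using dist_triangle[of y p "g y"] assms(3) by simp
  also have "\<dots> \<le> dist y (g y) + c * dist y p"
    using assms(2)[of y p] by simp
  finally show ?thesis using assms(1) by (simp add: field_simps)
qed

lemma funpow_lipschitz:
  fixes g :: "'a::metric_space \<Rightarrow> 'a"
  assumes "0 \<le> c" "\<And>x y. dist (g x) (g y) \<le> c * dist x y"
  shows "dist ((g ^^ n) x) ((g ^^ n) y) \<le> c ^ n * dist x y"
proof (induction n)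
  case (Suc n)
  have "dist ((g ^^ Suc n) x) ((g ^^ Suc n) y) \<le> c * dist ((g ^^ n) x) ((g ^^ n) y)"
    using assms(2)[of "(g ^^ n) x" "(g ^^ n) y"] by simp
  also have "\<dots> \<le> c * (c ^ n * dist x y)"
    using Suc assms(1) by (rule mult_left_mono)
  finally show ?case by (simp add: mult.assoc)
qed simp

text \<open>The first factor \<open>f\<close> keeps the constants \<open>1 - Lip\<close> bounded away from zero uniformly in \<open>n\<close>, and
  \<open>f x\<close> is almost fixed by \<open>f \<circ> g ^^ n\<close> because \<open>g ^^ n\<close> fixes \<open>x\<close> and brings \<open>f x\<close> close to it.\<close>

lemma fixed_points_compose_funpow_tendsto:
  assumes f: "contraction_map f" and g: "contraction_map g" and x: "g x = x"
    and p: "\<And>n. f ((g ^^ n) (p n)) = p n"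
  shows "p \<longlonglongrightarrow> f x"
proof -
  obtain c where c: "0 < c" "c < 1" "\<And>x y. dist (f x) (f y) \<le> c * dist x y"
    using f by (auto simp: contraction_map_def)
  obtain d where d: "0 < d" "d < 1" "\<And>x y. dist (g x) (g y) \<le> d * dist x y"
    using g by (auto simp: contraction_map_def)
  have fg: "dist (f ((g ^^ n) u)) (f ((g ^^ n) v)) \<le> c * (d ^ n * dist u v)" for n u v
  proof -
    have "dist (f ((g ^^ n) u)) (f ((g ^^ n) v)) \<le> c * dist ((g ^^ n) u) ((g ^^ n) v)"
      by (rule c)
    also have "\<dots> \<le> c * (d ^ n * dist u v)"
      using c d by (intro mult_left_mono funpow_lipschitz) auto
    finally show ?thesis .
  qed
  have fixed: "(g ^^ n) x = x" for n by (induction n) (simp_all add: x)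
  define K where "K = c * dist x (f x) / (1 - c)"
  have bound: "dist (p n) (f x) \<le> d ^ n * K" for n
  proof -
    have "dist (f ((g ^^ n) u)) (f ((g ^^ n) v)) \<le> c * dist u v" for u v
    proof -
      have "d ^ n * dist u v \<le> 1 * dist u v"
        using d by (intro mult_right_mono power_le_one) auto
      then have "c * (d ^ n * dist u v) \<le> c * dist u v"
        using c(1) by (intro mult_left_mono) auto
      with fg[of n u v] show ?thesis by (rule order_trans)
    qed
    then have "dist (f x) (p n) \<le> dist (f x) (f ((g ^^ n) (f x))) / (1 - c)"
      using dist_fixed_point_le[of c "\<lambda>u. f ((g ^^ n) u)" "p n" "f x"] c(2) p by blast
    also have "\<dots> \<le> c * (d ^ n * dist x (f x)) / (1 - c)"
      using fg[of n x "f x"] c(2) by (intro divide_right_mono) (simp_all add: fixed)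
    finally show ?thesis by (simp add: K_def dist_commute mult_ac)
  qed
  have "(\<lambda>n. d ^ n * K) \<longlonglongrightarrow> 0"
    using d by (intro tendsto_mult_left_zero LIMSEQ_realpow_zero) auto
  then have "(\<lambda>n. dist (p n) (f x)) \<longlonglongrightarrow> 0"
    by (rule tendsto_sandwich[OF _ _ tendsto_const, rotated 2]) (simp_all add: bound)
  then show ?thesis by (rule tendsto_dist_iff[THEN iffD2])
qed

lemma word_map_Nil [simp]: "word_map F [] = id"
  by (simp add: word_map_def)

lemma word_map_Cons [simp]: "word_map F (i # w) = F i \<circ> word_map F w"
  by (simp add: word_map_def)

lemma word_map_append: "word_map F (v @ w) = word_map F v \<circ> word_map F w"
  by (induction v) (simp_all add: comp_assoc)

lemma word_map_concat_replicate:
  "word_map F (concat (replicate n w)) = word_map F w ^^ n"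
  by (induction n) (simp_all add: word_map_append)

lemma word_fixed_pointsI:
  assumes "w \<noteq> []" "word_map F w x = x"
  shows "x \<in> word_fixed_points F"
  using assms unfolding word_fixed_points_def by blast

lemma contraction_map_word_map:
  assumes "\<And>i. contraction_map (F i)" "w \<noteq> []"
  shows "contraction_map (word_map F w)"
  using assms(2)
proof (induction w rule: list_nonempty_induct)
  case (single i)
  then show ?case using assms(1) by simp
next
  case (cons i w)
  then show ?case unfolding word_map_Cons by (intro contraction_map_compose assms(1))
qed

lemma word_map_image_subset:
  assumes "\<And>i. F i ` A \<subseteq> A"
  shows "word_map F w ` A \<subseteq> A"
  using assms by (induction w) (auto simp: image_subset_iff)

text \<open>Banach's theorem inside \<open>A\<close> yields a fixed point of the same word, and since a contraction
  has only one fixed point in the whole space, it is the given one.\<close>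

lemma word_fixed_points_subset_closed:
  fixes F :: "nat \<Rightarrow> 'a::complete_space \<Rightarrow> 'a"
  assumes F: "\<And>i. contraction_map (F i)"
    and A: "closed A" "A \<noteq> {}" "\<And>i. F i ` A \<subseteq> A"
  shows "word_fixed_points F \<subseteq> A"
proof
  fix x assume "x \<in> word_fixed_points F"
  then obtain w where w: "w \<noteq> []" "word_map F w x = x"
    by (auto simp: word_fixed_points_def)
  have contr: "contraction_map (word_map F w)"
    using F w(1) by (rule contraction_map_word_map)
  obtain y where "y \<in> A" "word_map F w y = y"
    using contraction_map_fixed_point_exists[OF contr A(1,2) word_map_image_subset] A(3) by blast
  with contraction_map_fixed_point_unique[OF contr w(2)] show "x \<in> A" by simp
qed

text \<open>If \<open>x\<close> is fixed by the word \<open>i # v\<close>, then its preimage under \<open>F i\<close> can be chosen as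
  \<open>word_map F v x\<close>, which the rotated word \<open>v @ [i]\<close> fixes.\<close>

lemma word_fixed_points_subset_images:
  "word_fixed_points F \<subseteq> (\<Union>i. F i ` word_fixed_points F)"
proof
  fix x assume "x \<in> word_fixed_points F"
  then obtain w where w: "w \<noteq> []" "word_map F w x = x"
    unfolding word_fixed_points_def by blast
  obtain i v where iv: "w = i # v"
    using w(1) by (cases w) simp_all
  have x: "F i (word_map F v x) = x"
    using w(2) unfolding iv word_map_Cons comp_apply .
  have "word_map F (v @ [i]) (word_map F v x) = word_map F v x"
    by (simp add: word_map_append x)
  then have "word_map F v x \<in> word_fixed_points F"
    by (rule word_fixed_pointsI[rotated]) simp
  then have "F i (word_map F v x) \<in> F i ` word_fixed_points F" by (rule imageI)
  then have "x \<in> F i ` word_fixed_points F" unfolding x .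
  then show "x \<in> (\<Union>i. F i ` word_fixed_points F)" by (rule UN_I[OF UNIV_I])
qed

text \<open>If the word \<open>w\<close> fixes \<open>x\<close>, the approximating points are the fixed points of the words
  \<open>i w w \<dots> w\<close>.\<close>

lemma image_word_fixed_points_subset_closure:
  fixes F :: "nat \<Rightarrow> 'a::complete_space \<Rightarrow> 'a"
  assumes F: "\<And>i. contraction_map (F i)"
  shows "F i ` word_fixed_points F \<subseteq> closure (word_fixed_points F)"
proof (rule image_subsetI)
  fix x assume "x \<in> word_fixed_points F"
  then obtain w where w: "w \<noteq> []" "word_map F w x = x"
    by (auto simp: word_fixed_points_def)
  define u where "u n = i # concat (replicate n w)" for n
  have "\<exists>p. word_map F (u n) p = p" for n
  proof -
    have "contraction_map (word_map F (u n))"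
      by (intro contraction_map_word_map F) (simp add: u_def)
    from contraction_map_fixed_point_exists[OF this, of UNIV] show ?thesis by auto
  qed
  then obtain p where p: "word_map F (u n) (p n) = p n" for n by metis
  have "p \<longlonglongrightarrow> F i x"
    using F contraction_map_word_map[OF F w(1)] w(2)
  proof (rule fixed_points_compose_funpow_tendsto)
    show "F i ((word_map F w ^^ n) (p n)) = p n" for n
      using p[of n] by (simp add: u_def word_map_concat_replicate)
  qed
  moreover have "p n \<in> word_fixed_points F" for n
    by (rule word_fixed_pointsI[OF _ p]) (simp add: u_def)
  ultimately show "F i x \<in> closure (word_fixed_points F)"
    unfolding closure_sequential by blast
qed

lemma invariant_set_closure_word_fixed_points:
  fixes F :: "nat \<Rightarrow> 'a::complete_space \<Rightarrow> 'a"
  assumes F: "\<And>i. contraction_map (F i)"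
  shows "invariant_set F (closure (word_fixed_points F))"
proof -
  let ?P = "word_fixed_points F"
  obtain x where "F 0 x = x"
    using contraction_map_fixed_point_exists[OF F[of 0] closed_UNIV UNIV_not_empty subset_UNIV]
    by (elim bexE)
  then have "word_map F [0] x = x"
    unfolding word_map_Cons word_map_Nil comp_apply id_apply .
  with list.distinct(2) have "x \<in> ?P"
    by (rule word_fixed_pointsI)
  then have nonempty: "closure ?P \<noteq> {}"
    by (auto simp: closure_eq_empty)
  have "(\<Union>i. F i ` closure ?P) \<subseteq> closure ?P"
    by (intro UN_least image_closure_subset contraction_map_continuous_on F closed_closure
        image_word_fixed_points_subset_closure)
  then have "closure (\<Union>i. F i ` closure ?P) \<subseteq> closure ?P"
    by (rule closure_minimal) (rule closed_closure)
  moreover have "(\<Union>i. F i ` ?P) \<subseteq> (\<Union>i. F i ` closure ?P)"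
    by (intro UN_mono image_mono closure_subset order_refl)
  with word_fixed_points_subset_images have "?P \<subseteq> (\<Union>i. F i ` closure ?P)"
    by (rule order_trans)
  then have "closure ?P \<subseteq> closure (\<Union>i. F i ` closure ?P)"
    by (rule closure_mono)
  ultimately have "closure ?P = closure (\<Union>i. F i ` closure ?P)"
    by (rule equalityI[rotated])
  with nonempty show ?thesis unfolding invariant_set_def by (rule conjI)
qed

theorem theorem2p2:
  fixes F :: "nat \<Rightarrow> 'a::complete_space \<Rightarrow> 'a"
  assumes "\<And>i. contraction_map (F i)"
  shows "invariant_set F (closure (word_fixed_points F)) \<and>
         (\<forall>A. invariant_set F A \<longrightarrow> closure (word_fixed_points F) \<subseteq> A)"
proof (intro conjI allI impI)
  show "invariant_set F (closure (word_fixed_points F))"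
    using assms by (rule invariant_set_closure_word_fixed_points)
next
  fix A assume inv: "invariant_set F A"
  have ne: "A \<noteq> {}"
    using inv unfolding invariant_set_def by (rule conjunct1)
  have eq: "closure (\<Union>i. F i ` A) = A"
    using inv unfolding invariant_set_def by (rule conjunct2[THEN sym])
  have closed: "closed A" using closed_closure[of "\<Union>i. F i ` A"] unfolding eq .
  have image: "F i ` A \<subseteq> A" for i
  proof -
    have "F i ` A \<subseteq> closure (\<Union>i. F i ` A)"
      by (rule order_trans[OF _ closure_subset]) blast
    then show ?thesis unfolding eq .
  qed
  have "word_fixed_points F \<subseteq> A"
    by (rule word_fixed_points_subset_closed) (fact assms closed ne image)+
  then show "closure (word_fixed_points F) \<subseteq> A"
    using closed by (rule closure_minimal)
qed

end
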